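(* Let $H$ be a hamburger graph with $k$ pairs of distinguished vertices, let $M_H$ be its $2k\times 2k$ hamburger matrix, and let $c^+$ and $c^-$ be the numbers of positive and negative cycle systems in $H$, respectively. Then $\det M_H = c^+-c^-$.
   Context: All graphs are finite and directed. A hamburger graph $H$ consists of two vertex-disjoint acyclic directed graphs $G_1$ and $G_2$ and a connecting edge set $E_3$, as follows. $G_1$ has $k$ distinguished vertices $v_1,\dots,v_k$ such that there is a (nontrivial) directed path in $G_1$ from $v_i$ to $v_j$ only if $i<j$. $G_2$ has $k$ distinguished vertices $w_{k+1},\dots,w_{2k}$ such that there is a (nontrivial) directed path in $G_2$ from $w_i$ to $w_j$ only if $i>j$. $G_1$ and $G_2$ may have further, non-distinguished vertices. The set $E_3$ consists of exactly the edges $e_i: v_i\to w_{k+i}$ and $e_i': w_{k+i}\to v_i$ for $1\le i\le k$. No planarity is assumed. The hamburger matrix is the block matrix $$M_H=\begin{bmatrix} A & I_k\\ -I_k & B\end{bmatrix},$$ where $A=(a_{ij})$ is the upper triangular $k\times k$ matrix with $a_{ij}$ the number of directed paths from $v_i$ to $v_j$ in $G_1$, and $B=(b_{ij})$ is the lower triangular $k\times k$ matrix with $b_{ij}$ the number of directed paths from $w_{k+i}$ to $w_{k+j}$ in $G_2$. The trivial (length $0$) path is counted, so $a_{ii}=b_{ii}=1$. A cycle system $\mathcal C$ in $H$ is a (possibly empty) collection of pairwise vertex-disjoint directed cycles in $H$, where a cycle is a closed directed path with no repeated vertices (the 2-cycles $v_i\to w_{k+i}\to v_i$ are allowed). Let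 $l$ be the number of edges in $\mathcal C$ going from $G_2$ to $G_1$ and $m$ the number of cycles in $\mathcal C$. The cycle system is positive if $(-1)^{l+m}=+1$ and negative if $(-1)^{l+m}=-1$. *)

theory Defs
  imports "Graph_Theory.Graph_Theory" "Jordan_Normal_Form.Determinant"
begin

text \<open>
  A digraph is a record of type \<^typ>\<open>('a, 'b) pre_digraph\<close>; parallel arcs are permitted inside
  the two halves of a hamburger graph, and paths and cycles are told apart by their arcs. For digraphs
  without parallel arcs this is the same as telling them apart by their vertex sequences.
\<close>

definition acyclic_digraph :: "('a, 'b) pre_digraph \<Rightarrow> bool" where
  "acyclic_digraph G \<longleftrightarrow> \<not> (\<exists>p. pre_digraph.cycle G p)"

text \<open>
  Only \<open>v i\<close> for \<open>1 \<le> i \<le> k\<close> and \<open>w i\<close> for \<open>k + 1 \<le> i \<le> 2 * k\<close> are meaningful.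
  The subgraph conditions make \<open>G1\<close> and \<open>G2\<close> well-formed and force the incidence
  functions of \<open>G1\<close>, \<open>G2\<close> and \<open>H\<close> to agree. Injectivity of \<open>e\<close> and \<open>e'\<close>, and disjointness
  of their ranges from each other and from the arcs of \<open>G1\<close> and \<open>G2\<close>, follow from the
  prescribed end points.
\<close>

locale hamburger_graph = fin_digraph H
  for H :: "('a, 'b) pre_digraph" +
  fixes G1 G2 :: "('a, 'b) pre_digraph"
    and k :: nat
    and v w :: "nat \<Rightarrow> 'a"
    and e e' :: "nat \<Rightarrow> 'b"
  assumes subgraph_G1: "subgraph G1 H"
    and subgraph_G2: "subgraph G2 H"
    and verts_H: "verts H = verts G1 \<union> verts G2"
    and verts_disjoint: "verts G1 \<inter> verts G2 = {}"
    and acyclic_G1: "acyclic_digraph G1"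
    and acyclic_G2: "acyclic_digraph G2"
    and v_in_G1: "v ` {1..k} \<subseteq> verts G1"
    and v_inj: "inj_on v {1..k}"
    and w_in_G2: "w ` {k+1..2*k} \<subseteq> verts G2"
    and w_inj: "inj_on w {k+1..2*k}"
    and v_order: "\<And>i j p. \<lbrakk>i \<in> {1..k}; j \<in> {1..k}; pre_digraph.apath G1 (v i) p (v j); p \<noteq> []\<rbrakk>
          \<Longrightarrow> i < j"
    and w_order: "\<And>i j p. \<lbrakk>i \<in> {k+1..2*k}; j \<in> {k+1..2*k};
          pre_digraph.apath G2 (w i) p (w j); p \<noteq> []\<rbrakk> \<Longrightarrow> i > j"
    and arcs_H: "arcs H = arcs G1 \<union> arcs G2 \<union> e ` {1..k} \<union> e' ` {1..k}"
    and tail_e: "\<And>i. i \<in> {1..k} \<Longrightarrow> tail H (e i) = v i"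
    and head_e: "\<And>i. i \<in> {1..k} \<Longrightarrow> head H (e i) = w (k + i)"
    and tail_e': "\<And>i. i \<in> {1..k} \<Longrightarrow> tail H (e' i) = w (k + i)"
    and head_e': "\<And>i. i \<in> {1..k} \<Longrightarrow> head H (e' i) = v i"

definition num_paths :: "('a, 'b) pre_digraph \<Rightarrow> 'a \<Rightarrow> 'a \<Rightarrow> nat" where
  "num_paths G x y = card {p. pre_digraph.apath G x p y}"

text \<open>Matrices are indexed from 0, the distinguished vertices from 1, whence the shifts below.\<close>

definition hamburger_matrix ::
  "('a, 'b) pre_digraph \<Rightarrow> ('a, 'b) pre_digraph \<Rightarrow> nat \<Rightarrow> (nat \<Rightarrow> 'a) \<Rightarrow> (nat \<Rightarrow> 'a) \<Rightarrow> int mat" where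
  "hamburger_matrix G1 G2 k v w = four_block_mat
     (mat k k (\<lambda>(i, j). int (num_paths G1 (v (i + 1)) (v (j + 1))))) (1\<^sub>m k)
     (- 1\<^sub>m k) (mat k k (\<lambda>(i, j). int (num_paths G2 (w (k + (i + 1))) (w (k + (j + 1))))))"

text \<open>
  The library's \<^const>\<open>pre_digraph.cycle\<close> is a list of arcs with a chosen starting point. A cycle
  has no repeated vertices, so its arc set determines the list up to rotation; cycles are
  therefore represented by their arc sets. The vertices of a cycle are the tails of its arcs.
\<close>

definition dicycles :: "('a, 'b) pre_digraph \<Rightarrow> 'b set set" where
  "dicycles G = {set p | p. pre_digraph.cycle G p}"

definition cycle_systems :: "('a, 'b) pre_digraph \<Rightarrow> 'b set set set" where
  "cycle_systems G = {C. C \<subseteq> dicycles G \<and> pairwise (\<lambda>c d. tail G ` c \<inter> tail G ` d = {}) C}"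

text \<open>The exponent is \<open>l + m\<close>: the arcs from \<open>G2\<close> to \<open>G1\<close>, plus the number of cycles.\<close>

definition cycle_system_sign ::
  "('a, 'b) pre_digraph \<Rightarrow> ('a, 'b) pre_digraph \<Rightarrow> ('a, 'b) pre_digraph \<Rightarrow> 'b set set \<Rightarrow> int" where
  "cycle_system_sign H G1 G2 C =
     (- 1) ^ (card {a \<in> \<Union>C. tail H a \<in> verts G2 \<and> head H a \<in> verts G1} + card C)"

definition num_positive_cycle_systems ::
  "('a, 'b) pre_digraph \<Rightarrow> ('a, 'b) pre_digraph \<Rightarrow> ('a, 'b) pre_digraph \<Rightarrow> nat" where
  "num_positive_cycle_systems H G1 G2 =
     card {C \<in> cycle_systems H. cycle_system_sign H G1 G2 C = 1}"

definition num_negative_cycle_systems ::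
  "('a, 'b) pre_digraph \<Rightarrow> ('a, 'b) pre_digraph \<Rightarrow> ('a, 'b) pre_digraph \<Rightarrow> nat" where
  "num_negative_cycle_systems H G1 G2 =
     card {C \<in> cycle_systems H. cycle_system_sign H G1 G2 C = - 1}"

end

theory Submission
  imports Defs "HOL-Combinatorics.Cycles"
begin

text \<open>
  For a finite digraph with weighted arcs and weighted adjacency matrix \<open>N\<close>, the Leibniz expansion of
  \<open>det (I - N)\<close> is the sum of \<open>(-1)\<close> to the number of cycles, times the weight, over all cycle
  systems. Giving weight \<open>-1\<close> to the arcs from \<open>G2\<close> to \<open>G1\<close> and \<open>1\<close> to all others turns this
  sum for \<open>H\<close> into the number of positive minus the number of negative cycle systems. Without the
  connecting arcs the digraph is acyclic; so for the remaining adjacency matrix \<open>N'\<close> the matrix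
  \<open>D = I - N'\<close> has determinant 1, and its inverse \<open>R\<close> counts paths. The connecting arcs perturb
  \<open>D\<close> by a matrix that factors through the \<open>2 * k\<close> distinguished vertices, and the matrix
  determinant lemma transfers the determinant to \<open>M\<^sub>H\<close>, which is \<open>R\<close> restricted to these
  vertices plus the block matrix with rows \<open>(0, I)\<close> and \<open>(-I, 0)\<close>.
\<close>

section \<open>Permutations and products\<close>

text \<open>When the product is multiplied out, each \<open>x\<close> in \<open>U\<close>
  contributes either \<open>d x\<close> or one \<open>g a\<close> with \<open>a\<close> in the fibre
  of \<open>t\<close> over \<open>x\<close>. The elements chosen form a set \<open>S\<close> with at
  most one element per fibre, and \<open>S\<close> determines the choices. With
  \<open>t = tail G\<close> this gives sets of arcs with distinct tails.\<close>

lemma prod_add_sum_fibres: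
  fixes d :: "'a \<Rightarrow> 'c :: comm_semiring_1"
  assumes "finite U" "finite X"
  shows "(\<Prod>x\<in>U. d x + (\<Sum>a | a \<in> X \<and> t a = x. g a)) =
    (\<Sum>S | S \<subseteq> X \<and> inj_on t S \<and> t ` S \<subseteq> U. (\<Prod>a\<in>S. g a) * (\<Prod>x\<in>U - t ` S. d x))"
proof -
  let ?E = "\<lambda>x. {a. a \<in> X \<and> t a = x}"
  have "(\<Prod>x\<in>U. d x + sum g (?E x)) = (\<Prod>x\<in>U. sum g (?E x) + d x)"
    by (simp add: add.commute)
  also have "\<dots> = (\<Sum>T\<in>Pow U. (\<Prod>x\<in>T. sum g (?E x)) * (\<Prod>x\<in>U - T. d x))"
    by (rule prod_add[OF assms(1)])
  also have "\<dots> = (\<Sum>T\<in>Pow U. \<Sum>f\<in>PiE T ?E. (\<Prod>x\<in>T. g (f x)) * (\<Prod>x\<in>U - T. d x))"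
    using assms by (intro sum.cong refl, subst prod_sum_PiE)
      (auto simp: sum_distrib_right intro: finite_subset)
  also have "\<dots> = (\<Sum>(T, f)\<in>(SIGMA T:Pow U. PiE T ?E).
      (\<Prod>x\<in>T. g (f x)) * (\<Prod>x\<in>U - T. d x))"
    using assms by (subst sum.Sigma) (auto intro!: finite_PiE intro: finite_subset)
  also have "\<dots> = (\<Sum>S | S \<subseteq> X \<and> inj_on t S \<and> t ` S \<subseteq> U.
      (\<Prod>a\<in>S. g a) * (\<Prod>x\<in>U - t ` S. d x))"
  \<comment> \<open>A pair \<open>(T, f)\<close> is a section \<open>f\<close> of \<open>t\<close>
    over \<open>T\<close> and corresponds to its image \<open>S\<close>. The section is recovered by
    inverting \<open>t\<close> on \<open>S\<close>; the restriction is needed because members of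
    \<open>PiE\<close> are \<open>undefined\<close> outside \<open>T\<close>.\<close>
  proof (rule sum.reindex_bij_witness[where i = "\<lambda>S. (t ` S, restrict (the_inv_into S t) (t ` S))"
        and j = "\<lambda>(T, f). f ` T"], goal_cases)
    case (1 q)
    then obtain T f where q: "q = (T, f)" "T \<subseteq> U" "f \<in> PiE T ?E" by auto
    have tf: "t (f x) = x" if "x \<in> T" for x using q that by (auto simp: PiE_iff)
    then have inj: "inj_on t (f ` T)" by (auto intro!: inj_onI)
    have img: "t ` f ` T = T" using tf by (force simp: image_iff)
    have "restrict (the_inv_into (f ` T) t) T = f"
    proof
      fix x show "restrict (the_inv_into (f ` T) t) T x = f x"
      proof (cases "x \<in> T")
        case True
        then show ?thesis using the_inv_into_f_f[OF inj, of "f x"] tf[of x] by simp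
      next
        case False
        then show ?thesis using PiE_arb[OF q(3)] by simp
      qed
    qed
    then show ?case using q img by simp
  next
    case (2 q)
    then obtain T f where q: "q = (T, f)" "T \<subseteq> U" "f \<in> PiE T ?E" by auto
    have tf: "t (f x) = x" if "x \<in> T" for x using q that by (auto simp: PiE_iff)
    then have "inj_on t (f ` T)" by (auto intro!: inj_onI)
    then show ?case using q tf by (auto simp: PiE_iff)
  next
    case (3 S)
    then show ?case by (auto simp: the_inv_into_f_f image_iff)
  next
    case (4 S)
    then show ?case by (auto simp: the_inv_into_f_f)
  next
    case (5 q)
    then obtain T f where q: "q = (T, f)" "T \<subseteq> U" "f \<in> PiE T ?E" by auto
    have tf: "t (f x) = x" if "x \<in> T" for x using q that by (auto simp: PiE_iff)
    then have inj: "inj_on f T" by (metis inj_onI)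
    have img: "t ` f ` T = T" using tf by (force simp: image_iff)
    show ?case using q inj img by (simp add: prod.reindex)
  qed
  finally show ?thesis .
qed

text \<open>The recursion of \<open>cycle_of_list\<close> splits off one transposition per entry
  until one entry is left, and each changes the sign. For the empty list the permutation is the
  identity, and the formula would give the wrong sign.\<close>

lemma sign_cycle_of_list:
  assumes "distinct cs" "cs \<noteq> []"
  shows "sign (cycle_of_list cs) = (- 1) ^ (length cs + 1)"
  using assms
proof (induction cs rule: cycle_of_list.induct)
  case (1 i j cs)
  have "sign (cycle_of_list (i # j # cs)) = sign (transpose i j) * sign (cycle_of_list (j # cs))"
    unfolding cycle_of_list.simps(1)
    by (rule sign_compose[OF permutation_swap_id permutation_of_cycle])
  with 1 show ?case by (simp add: sign_swap_id del: cycle_of_list.simps)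
qed auto

lemma map_cycle_of_list: "distinct cs \<Longrightarrow> map (cycle_of_list cs) cs = rotate1 cs"
  using cyclic_rotation[of cs 1] by simp

text \<open>Conjugation by \<open>u\<close> is a sign-preserving bijection between the permutations
  of \<open>A\<close> and those of \<open>V\<close>. It moves Leibniz sums from matrix indices to
  vertices.\<close>

lemma sum_permutes_reindex:
  fixes f :: "'a \<Rightarrow> 'a \<Rightarrow> 'c :: comm_ring_1"
  assumes u: "bij_betw u A V" and fin: "finite A"
  shows "(\<Sum>p | p permutes A. of_int (sign p) * (\<Prod>i\<in>A. f (u i) (u (p i)))) =
    (\<Sum>p | p permutes V. of_int (sign p) * (\<Prod>x\<in>V. f x (p x)))"
proof (rule sum.reindex_bij_witness[where j = "map_permutation A u"
      and i = "map_permutation V (inv_into A u)"], goal_cases)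
  case (1 p)
  then show ?case
    using u by (intro map_permutation_compose_inv[OF u]) (auto simp: bij_betw_def)
next
  case (2 p)
  then show ?case using map_permutation_permutes[OF u] by simp
next
  case (3 p)
  then show ?case
    using u by (intro map_permutation_compose_inv[OF bij_betw_inv_into[OF u]])
      (auto simp: bij_betw_def f_inv_into_f)
next
  case (4 p)
  then show ?case using map_permutation_permutes[OF bij_betw_inv_into[OF u]] by simp
next
  case (5 p)
  have inj: "inj_on u A" using u by (simp add: bij_betw_def)
  have "(\<Prod>x\<in>V. f x (map_permutation A u p x)) = (\<Prod>i\<in>A. f (u i) (map_permutation A u p (u i)))"
    by (rule prod.reindex_bij_betw[OF u, symmetric])
  also have "\<dots> = (\<Prod>i\<in>A. f (u i) (u (p i)))"
    by (intro prod.cong refl) (simp add: map_permutation_apply[OF inj])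
  finally show ?case using 5 by (simp add: sign_map_permutation[OF inj _ fin])
qed

section \<open>Cycle systems as sets of arcs\<close>

text \<open>
  Taking the union of the cycles identifies cycle systems with the arc sets that enter and leave
  every vertex equally often, and at most once.
\<close>

definition circulations :: "('a, 'b) pre_digraph \<Rightarrow> 'b set set" where
  "circulations G = {S. S \<subseteq> arcs G \<and> inj_on (tail G) S \<and> inj_on (head G) S \<and>
     tail G ` S = head G ` S}"

text \<open>The identity off the tails makes a circulation a permutation of all vertices. The
  additional fixed points account for the vertices where a Leibniz term uses the identity part of
  \<open>I - N\<close>.\<close>

definition succ_perm :: "('a, 'b) pre_digraph \<Rightarrow> 'b set \<Rightarrow> 'a \<Rightarrow> 'a" where
  "succ_perm G S x = (if x \<in> tail G ` S then head G (the_inv_into S (tail G) x) else x)"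

lemma succ_perm_tail: "inj_on (tail G) S \<Longrightarrow> a \<in> S \<Longrightarrow> succ_perm G S (tail G a) = head G a"
  by (simp add: succ_perm_def the_inv_into_f_f)

lemma succ_perm_other: "x \<notin> tail G ` S \<Longrightarrow> succ_perm G S x = x"
  by (simp add: succ_perm_def)

lemma succ_perm_eqI:
  assumes "inj_on (tail G) S" "\<And>a. a \<in> S \<Longrightarrow> p (tail G a) = head G a"
    "\<And>x. x \<notin> tail G ` S \<Longrightarrow> p x = x"
  shows "succ_perm G S = p"
proof
  fix x show "succ_perm G S x = p x"
    using assms by (cases "x \<in> tail G ` S") (auto simp: succ_perm_tail succ_perm_other)
qed

lemma succ_perm_permutes:
  assumes "S \<in> circulations G"
  shows "succ_perm G S permutes tail G ` S"
proof (rule bij_imp_permutes)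
  have S: "inj_on (tail G) S" "inj_on (head G) S" "tail G ` S = head G ` S"
    using assms by (auto simp: circulations_def)
  show "bij_betw (succ_perm G S) (tail G ` S) (tail G ` S)"
    unfolding bij_betw_def
  proof
    show "inj_on (succ_perm G S) (tail G ` S)"
    proof (rule inj_onI, elim imageE)
      fix x y a b
      assume "succ_perm G S x = succ_perm G S y" "x = tail G a" "a \<in> S" "y = tail G b" "b \<in> S"
      then show "x = y" using S inj_onD[OF S(2), of a b] by (simp add: succ_perm_tail)
    qed
    have "succ_perm G S ` tail G ` S = head G ` S"
      unfolding image_image using S by (intro image_cong refl succ_perm_tail)
    then show "succ_perm G S ` tail G ` S = tail G ` S" using S by simp
  qed
qed (rule succ_perm_other)

text \<open>The head of an arc of \<open>T\<close> is again a tail of \<open>T\<close>, hence fixed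
  by the permutation of \<open>S\<close>. This lets signs be computed one cycle at a time.\<close>

lemma succ_perm_Un:
  assumes S: "S \<in> circulations G" and T: "T \<in> circulations G"
    and disj: "tail G ` S \<inter> tail G ` T = {}"
  shows "succ_perm G (S \<union> T) = succ_perm G S \<circ> succ_perm G T"
proof (rule succ_perm_eqI)
  show "inj_on (tail G) (S \<union> T)"
    using S T disj unfolding circulations_def inj_on_Un by blast
next
  fix a assume a: "a \<in> S \<union> T"
  show "(succ_perm G S \<circ> succ_perm G T) (tail G a) = head G a"
  proof (cases "a \<in> T")
    case True
    have "head G a \<in> tail G ` T" using True T by (auto simp: circulations_def)
    then have "head G a \<notin> tail G ` S" using disj by auto
    then show ?thesis using True T by (simp add: succ_perm_tail circulations_def succ_perm_other)
  next
    case False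
    then have "a \<in> S" using a by simp
    moreover from this have "tail G a \<notin> tail G ` T" using disj by auto
    ultimately show ?thesis using S by (simp add: succ_perm_tail circulations_def succ_perm_other)
  qed
next
  fix x assume "x \<notin> tail G ` (S \<union> T)"
  then show "(succ_perm G S \<circ> succ_perm G T) x = x"
    by (simp add: succ_perm_other image_Un)
qed

section \<open>Directed cycles and their arc sets\<close>

lemma (in pre_digraph) cas_iff_map:
  "p \<noteq> [] \<Longrightarrow> cas u p v \<longleftrightarrow> u = tail G (hd p) \<and> map (head G) p = tl (map (tail G) p) @ [v]"
proof (induction p arbitrary: u)
  case (Cons a p)
  then show ?case by (cases p) auto
qed simp

context wf_digraph
begin

text \<open>Consecutive arcs of a closed walk fit together exactly when the heads are the tails
  shifted cyclically by one place. Apart from the membership of the arcs, this form depends only on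
  the incidence functions, so it also compares cycles of a digraph with those of its
  subgraphs.\<close>

lemma cycle_iff_rotate:
  "pre_digraph.cycle G p \<longleftrightarrow> p \<noteq> [] \<and> set p \<subseteq> arcs G \<and> distinct (map (tail G) p) \<and>
     map (head G) p = rotate1 (map (tail G) p)" (is "_ \<longleftrightarrow> ?R")
proof
  assume "pre_digraph.cycle G p"
  then obtain u where u: "awalk u p u" "distinct (tl (awalk_verts u p))" "p \<noteq> []"
    unfolding cycle_def by blast
  have c: "cas u p u" "set p \<subseteq> arcs G" using u by auto
  have "tl (awalk_verts u p) = map (head G) p"
    using awalk_verts_conv'[OF c(1)] u(3) by simp
  moreover have "map (head G) p = rotate1 (map (tail G) p)"
    using c(1) u(3) cas_iff_map[of p u u] by (cases p) auto
  ultimately show ?R using u c by (metis distinct1_rotate)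
next
  assume R: ?R
  let ?u = "tail G (hd p)"
  have cas: "cas ?u p ?u" using R cas_iff_map[of p ?u ?u] by (cases p) auto
  then have "tl (awalk_verts ?u p) = map (head G) p"
    using awalk_verts_conv'[OF cas] R by simp
  then have "distinct (tl (awalk_verts ?u p))" using R by (metis distinct1_rotate)
  moreover have "awalk ?u p ?u"
    using R cas unfolding awalk_def by (cases p) auto
  ultimately show "pre_digraph.cycle G p" using R unfolding cycle_def by blast
qed

lemma dicycle_imp_circulation:
  assumes "c \<in> dicycles G"
  shows "c \<in> circulations G" "c \<noteq> {}" "finite c"
proof -
  obtain p where p: "c = set p" "p \<noteq> []" "set p \<subseteq> arcs G" "distinct (map (tail G) p)"
     "map (head G) p = rotate1 (map (tail G) p)"
    using assms by (auto simp: dicycles_def cycle_iff_rotate)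
  have "distinct (map (head G) p)" unfolding p(5) using p(4) by (simp only: distinct1_rotate)
  moreover have "set (map (head G) p) = set (map (tail G) p)" unfolding p(5) by (simp only: set_rotate1)
  ultimately show "c \<in> circulations G"
    using p(1,3,4) unfolding circulations_def distinct_map set_map by blast
  show "c \<noteq> {}" "finite c" using p by auto
qed

text \<open>Starting from any arc of \<open>X\<close> and passing repeatedly to the next arc of the
  cycle never leaves \<open>X\<close>, yet visits all of \<open>c\<close>.\<close>

lemma dicycle_minimal:
  assumes c: "c \<in> dicycles G" and X: "X \<subseteq> c" "X \<noteq> {}"
    and closed: "\<And>a b. a \<in> X \<Longrightarrow> b \<in> c \<Longrightarrow> tail G b = head G a \<Longrightarrow> b \<in> X"
  shows "X = c"
proof -
  obtain p where p: "c = set p" "p \<noteq> []"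
     "map (head G) p = rotate1 (map (tail G) p)"
    using c by (auto simp: dicycles_def cycle_iff_rotate)
  let ?n = "length p"
  have step: "head G (p ! i) = tail G (p ! (Suc i mod ?n))" if "i < ?n" for i
    using arg_cong[OF p(3), of "\<lambda>xs. xs ! i"] that p(2) nth_map[of "Suc i mod length p" p "tail G"]
    by (simp add: nth_rotate1)
  obtain i where i: "i < ?n" "p ! i \<in> X" using X p by (metis in_set_conv_nth ex_in_conv subsetD)
  have reach: "p ! ((i + j) mod ?n) \<in> X" for j
  proof (induction j)
    case (Suc j)
    have "(i + j) mod ?n < ?n" using p by simp
    from step[OF this] closed[OF Suc, of "p ! (Suc ((i + j) mod ?n) mod ?n)"]
    show ?case using p by (simp add: mod_Suc_eq)
  qed (use i in simp)
  have "c \<subseteq> X"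
  proof
    fix a assume "a \<in> c"
    then obtain j where j: "j < ?n" "a = p ! j" using p by (metis in_set_conv_nth)
    \<comment> \<open>Going \<open>?n - i\<close> places reaches the start of the list, and
      \<open>j\<close> more places reach position \<open>j\<close>; this offset avoids comparing
      \<open>i\<close> with \<open>j\<close>.\<close>
    have "(i + (?n - i + j)) mod ?n = j" using i j by simp
    then show "a \<in> X" using reach[of "?n - i + j"] j by simp
  qed
  then show ?thesis using X by simp
qed

lemma sign_succ_perm_dicycle:
  assumes "c \<in> dicycles G"
  shows "sign (succ_perm G c) = (- 1) ^ (card c + 1)"
proof -
  obtain p where p: "c = set p" "p \<noteq> []" "distinct (map (tail G) p)"
     "map (head G) p = rotate1 (map (tail G) p)"
    using assms by (auto simp: dicycles_def cycle_iff_rotate)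
  have "succ_perm G c = cycle_of_list (map (tail G) p)"
  proof (rule succ_perm_eqI)
    show "inj_on (tail G) c" using p by (simp add: distinct_map)
    have "map (cycle_of_list (map (tail G) p) \<circ> tail G) p = map (head G) p"
      using map_cycle_of_list[OF p(3)] p(4) by simp
    then show "cycle_of_list (map (tail G) p) (tail G a) = head G a" if "a \<in> c" for a
      using that p(1) by (metis comp_apply map_eq_conv)
    show "cycle_of_list (map (tail G) p) x = x" if "x \<notin> tail G ` c" for x
      using that p(1) by (intro id_outside_supp) simp
  qed
  moreover have "card c = length (map (tail G) p)"
    using p by (simp add: distinct_card distinct_map)
  ultimately show ?thesis using p sign_cycle_of_list[OF p(3)] by simp
qed

text \<open>The orbit of a tail under the successor permutation is finite and closes up; the arcs of
  \<open>S\<close> leaving its vertices form the required cycle.\<close>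

lemma circulation_contains_dicycle:
  assumes S: "S \<in> circulations G" "S \<noteq> {}" "finite S"
  shows "\<exists>c\<in>dicycles G. c \<subseteq> S"
proof -
  let ?f = "succ_perm G S" and ?g = "the_inv_into S (tail G)"
  have S': "S \<subseteq> arcs G" "inj_on (tail G) S" using S by (auto simp: circulations_def)
  have perm: "?f permutes tail G ` S" using S by (simp add: succ_perm_permutes)
  have "permutation ?f" using S perm permutation_permutes by blast
  obtain x where x: "x \<in> tail G ` S" using S by auto
  \<comment> \<open>\<open>support\<close> lists the iterates of \<open>?f\<close> at
    \<open>x\<close> before the first return to \<open>x\<close>, which happens after
    \<open>least_power ?f x\<close> steps.\<close>
  define xs where "xs = support ?f x"
  have dist: "distinct xs" unfolding xs_def
    by (rule cycle_of_permutation[OF \<open>permutation ?f\<close>])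
  have pow: "(?f ^^ i) x \<in> tail G ` S" for i
    by (induction i) (use x perm in \<open>auto simp: permutes_in_image simp del: image_iff\<close>)
  have xs: "set xs \<subseteq> tail G ` S"
    unfolding xs_def using pow by auto
  have lp: "(?f ^^ least_power ?f x) x = x" "least_power ?f x > 0"
    using least_power_of_permutation[OF \<open>permutation ?f\<close>] by auto
  have ne: "xs \<noteq> []" using lp unfolding xs_def by simp
  have rot: "map ?f xs = rotate1 xs"
  proof -
    obtain m where m: "least_power ?f x = Suc m" using lp(2) gr0_implies_Suc by blast
    have "map ?f xs = map (\<lambda>i. (?f ^^ i) x) (map Suc [0..<Suc m])"
      unfolding xs_def m by simp
    also have "\<dots> = map (\<lambda>i. (?f ^^ i) x) [1..<Suc m] @ [x]"
      using lp(1) unfolding m map_Suc_upt by simp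
    also have "\<dots> = rotate1 xs"
      unfolding xs_def m upt_conv_Cons[OF zero_less_Suc] by simp
    finally show ?thesis .
  qed
  \<comment> \<open>\<open>?g\<close> picks the unique arc of \<open>S\<close> that leaves a given
    vertex.\<close>
  let ?p = "map ?g xs"
  have tl: "map (tail G) ?p = xs"
    using xs S' by (auto simp: f_the_inv_into_f subset_iff intro!: map_idI)
  have hd: "map (head G) ?p = map ?f xs"
    using xs by (auto simp: succ_perm_def)
  have sub: "set ?p \<subseteq> S" using xs S' by (auto simp: the_inv_into_into subset_iff)
  have "pre_digraph.cycle G ?p"
    unfolding cycle_iff_rotate tl hd rot using ne dist sub S' by auto
  then have "set ?p \<in> dicycles G" unfolding dicycles_def by blast
  then show ?thesis using sub by blast
qed

lemma Union_cycle_system_circulation: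
  assumes "C \<in> cycle_systems G"
  shows "\<Union>C \<in> circulations G"
proof -
  have C: "\<And>c. c \<in> C \<Longrightarrow> c \<in> circulations G"
    using assms dicycle_imp_circulation(1) by (auto simp: cycle_systems_def)
  have disj: "\<And>c d. c \<in> C \<Longrightarrow> d \<in> C \<Longrightarrow> tail G ` c \<inter> tail G ` d \<noteq> {} \<Longrightarrow> c = d"
    using assms unfolding cycle_systems_def pairwise_def by blast
  have ht: "head G ` c = tail G ` c" if "c \<in> C" for c
    using C[OF that] by (simp add: circulations_def)
  have inj: "inj_on (tail G) c" "inj_on (head G) c" if "c \<in> C" for c
    using C[OF that] by (auto simp: circulations_def)
  have "inj_on (tail G) (\<Union>C)"
  proof (rule inj_onI)
    fix a b assume "a \<in> \<Union>C" "b \<in> \<Union>C" and eq: "tail G a = tail G b"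
    then obtain c d where cd: "c \<in> C" "a \<in> c" "d \<in> C" "b \<in> d" by auto
    then have "c = d" using disj[of c d] eq by auto
    then show "a = b" using cd inj eq by (metis inj_onD)
  qed
  moreover have "inj_on (head G) (\<Union>C)"
  proof (rule inj_onI)
    fix a b assume "a \<in> \<Union>C" "b \<in> \<Union>C" and eq: "head G a = head G b"
    then obtain c d where cd: "c \<in> C" "a \<in> c" "d \<in> C" "b \<in> d" by auto
    \<comment> \<open>Vertex-disjointness is stated for tails only; it applies to heads because
      every head on a cycle is also a tail on it.\<close>
    then have "head G a \<in> tail G ` c \<inter> tail G ` d" using ht eq by (metis IntI imageI)
    then have "c = d" using disj[of c d] cd by auto
    then show "a = b" using cd inj eq by (metis inj_onD)
  qed
  moreover have "tail G ` \<Union>C = head G ` \<Union>C" using ht by (simp add: image_Union)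
  moreover have "\<Union>C \<subseteq> arcs G" using C by (auto simp: circulations_def)
  ultimately show ?thesis by (simp add: circulations_def)
qed

text \<open>A cycle of \<open>C\<close> shares an arc with some cycle of \<open>D\<close>. Tails are
  distinct on the common union, so from a shared arc both cycles must continue with the same arc.
  Their intersection is thus closed under successors in each of them, and minimality makes both
  equal to it.\<close>

lemma cycle_system_subset_if_Union_eq:
  assumes C: "C \<in> cycle_systems G" and D: "D \<in> cycle_systems G" and eq: "\<Union>C = \<Union>D"
  shows "C \<subseteq> D"
proof
  fix c assume c: "c \<in> C"
  have dic: "c \<in> dicycles G" using c C by (auto simp: cycle_systems_def)
  obtain a where a: "a \<in> c" using dicycle_imp_circulation(2)[OF dic] by auto
  obtain d where d: "d \<in> D" "a \<in> d" using a c eq by auto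
  have did: "d \<in> dicycles G" using d D by (auto simp: cycle_systems_def)
  have inj: "inj_on (tail G) (\<Union>C)"
    using Union_cycle_system_circulation[OF C] by (simp add: circulations_def)
  have closed: "s \<in> y" if "x \<in> dicycles G" "y \<in> dicycles G" "x \<subseteq> \<Union>C" "y \<subseteq> \<Union>C"
    "r \<in> x \<inter> y" "s \<in> x" "tail G s = head G r" for x y r s
  proof -
    have "head G r \<in> tail G ` y"
      using dicycle_imp_circulation(1)[OF that(2)] that(5) by (auto simp: circulations_def)
    then obtain s' where "s' \<in> y" "tail G s' = tail G s" using \<open>tail G s = head G r\<close> by (metis imageE)
    then show "s \<in> y" using inj that by (metis inj_onD subsetD)
  qed
  have sub: "c \<subseteq> \<Union>C" "d \<subseteq> \<Union>C" using c d eq by auto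
  have "c \<inter> d = c"
    by (rule dicycle_minimal[OF dic]) (use a d closed[OF dic did sub] in auto)
  moreover have "c \<inter> d = d"
    by (rule dicycle_minimal[OF did]) (use a d closed[OF did dic sub(2,1)] in auto)
  ultimately show "c \<in> D" using d by simp
qed

text \<open>Remove one cycle and induct. A cycle has the same vertices as tails and as heads, so
  what remains is again a circulation, and injectivity of the tails keeps it vertex-disjoint from
  the removed cycle.\<close>

lemma circulation_eq_Union_cycle_system:
  assumes "finite S" "S \<in> circulations G"
  shows "\<exists>C\<in>cycle_systems G. \<Union>C = S"
  using assms
proof (induction S rule: finite_psubset_induct)
  case (psubset S)
  show ?case
  proof (cases "S = {}")
    case True
    then show ?thesis by (intro bexI[of _ "{}"]) (auto simp: cycle_systems_def)
  next
    case False
    then obtain c where c: "c \<in> dicycles G" "c \<subseteq> S"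
      using circulation_contains_dicycle psubset by metis
    have cc: "c \<in> circulations G" "c \<noteq> {}" using dicycle_imp_circulation[OF c(1)] by auto
    have inj: "inj_on (tail G) S" using psubset by (simp add: circulations_def)
    have injh: "inj_on (head G) S" using psubset by (simp add: circulations_def)
    have "tail G ` (S - c) = head G ` (S - c)"
      using psubset.prems cc(1) c(2) inj_on_image_set_diff[OF inj _ c(2), of S]
        inj_on_image_set_diff[OF injh _ c(2), of S] by (simp add: circulations_def)
    then have "S - c \<in> circulations G"
      using psubset.prems inj injh by (auto simp: circulations_def inj_on_diff)
    moreover have "S - c \<subset> S" using c cc by auto
    ultimately obtain C where C: "C \<in> cycle_systems G" "\<Union>C = S - c"
      using psubset.IH by metis
    have disj: "tail G ` c \<inter> tail G ` d = {}" if "d \<in> C" for d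
    proof -
      have "d \<subseteq> S - c" using that C by auto
      then show ?thesis using inj_on_image_Int[OF inj, of c d] c by auto
    qed
    have "insert c C \<in> cycle_systems G"
      using C(1) c(1) disj unfolding cycle_systems_def mem_Collect_eq pairwise_insert by blast
    moreover have "\<Union>(insert c C) = S" using C c by auto
    ultimately show ?thesis by blast
  qed
qed

end

section \<open>The determinant of a weighted digraph as a sum over cycle systems\<close>

context fin_digraph
begin

lemma finite_cycle_systems: "finite (cycle_systems G)"
proof -
  have "cycle_systems G \<subseteq> Pow (Pow (arcs G))"
    using dicycle_imp_circulation(1) by (auto simp: cycle_systems_def circulations_def)
  then show ?thesis using finite_arcs by (meson finite_Pow_iff finite_subset)
qed

lemma bij_betw_Union_cycle_systems: "bij_betw Sup (cycle_systems G) (circulations G)"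
proof (rule bij_betw_imageI)
  show "inj_on Sup (cycle_systems G)"
  proof (rule inj_onI)
    fix C D assume "C \<in> cycle_systems G" "D \<in> cycle_systems G" "\<Union>C = \<Union>D"
    then show "C = D" using cycle_system_subset_if_Union_eq by (metis subset_antisym)
  qed
next
  show "Sup ` cycle_systems G = circulations G"
  proof (intro equalityI subsetI)
    fix S assume S: "S \<in> circulations G"
    then have "finite S" using finite_arcs by (auto simp: circulations_def intro: finite_subset)
    then show "S \<in> Sup ` cycle_systems G"
      using circulation_eq_Union_cycle_system S by (metis imageI)
  qed (auto simp: Union_cycle_system_circulation)
qed

lemma cycle_system_finite:
  assumes "C \<in> cycle_systems G"
  shows "finite C" "finite (\<Union>C)"
proof -
  have "\<Union>C \<subseteq> arcs G"
    using Union_cycle_system_circulation[OF assms] by (simp add: circulations_def)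
  then show "finite (\<Union>C)" using finite_arcs finite_subset by blast
  then show "finite C" by (rule finite_UnionD)
qed

text \<open>The successor permutation is the product of disjoint cyclic permutations, and a cycle
  \<open>c\<close> contributes the sign of exponent \<open>card c + 1\<close>; the summands 1 add up
  to \<open>card C\<close>.\<close>

lemma sign_succ_perm_cycle_system:
  assumes "C \<in> cycle_systems G"
  shows "sign (succ_perm G (\<Union>C)) = (- 1) ^ (card (\<Union>C) + card C)"
  using cycle_system_finite(1)[OF assms] assms
proof (induction C rule: finite_induct)
  case empty
  have "succ_perm G {} = id" by (auto simp: succ_perm_def)
  then show ?case by simp
next
  case (insert c C)
  have c: "c \<in> dicycles G" and C: "C \<in> cycle_systems G"
    and disj: "\<And>d. d \<in> C \<Longrightarrow> tail G ` c \<inter> tail G ` d = {}"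
    using insert.prems insert.hyps by (auto simp: cycle_systems_def pairwise_insert)
  have cc: "c \<in> circulations G" "finite c" using dicycle_imp_circulation[OF c] by auto
  have CC: "\<Union>C \<in> circulations G" "finite (\<Union>C)"
    using Union_cycle_system_circulation[OF C] cycle_system_finite(2)[OF C] by auto
  have td: "tail G ` c \<inter> tail G ` \<Union>C = {}" using disj by blast
  then have "c \<inter> \<Union>C = {}" by blast
  then have card: "card (\<Union>(insert c C)) = card c + card (\<Union>C)"
    using cc CC by (simp add: card_Un_disjoint)
  have perms: "permutation (succ_perm G c)" "permutation (succ_perm G (\<Union>C))"
    using succ_perm_permutes cc CC permutation_permutes by blast+
  have "succ_perm G (\<Union>(insert c C)) = succ_perm G c \<circ> succ_perm G (\<Union>C)"
    using succ_perm_Un[OF cc(1) CC(1) td] by simp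
  then have "sign (succ_perm G (\<Union>(insert c C))) =
      (- 1) ^ (card c + 1) * (- 1) ^ (card (\<Union>C) + card C)"
    using sign_compose[OF perms] sign_succ_perm_dicycle[OF c] insert.IH[OF C] by simp
  then show ?case using card insert.hyps by (simp add: power_add)
qed

text \<open>The left set indexes the terms that survive when the Leibniz product for
  \<open>p\<close> is expanded: every chosen arc follows \<open>p\<close>, and a vertex without a
  chosen arc must be fixed by \<open>p\<close>, since otherwise its diagonal factor is zero.\<close>

lemma circulations_with_succ_perm:
  assumes p: "p permutes verts G"
  shows "{S. S \<subseteq> {a \<in> arcs G. head G a = p (tail G a)} \<and> inj_on (tail G) S \<and>
      tail G ` S \<subseteq> verts G \<and> (\<forall>x\<in>verts G - tail G ` S. p x = x)} =
    {S \<in> circulations G. succ_perm G S = p}" (is "?L = ?R")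
proof (intro equalityI subsetI)
  fix S assume "S \<in> ?L"
  then have S: "S \<subseteq> arcs G" "inj_on (tail G) S" "\<And>x. x \<in> verts G - tail G ` S \<Longrightarrow> p x = x"
    and hd: "\<And>a. a \<in> S \<Longrightarrow> head G a = p (tail G a)"
    by blast+
  have h: "head G ` S = p ` tail G ` S" unfolding image_image by (intro image_cong refl hd)
  have fixed: "p x = x" if "x \<notin> tail G ` S" for x
    using S(3)[of x] that permutes_not_in[OF p, of x] by blast
  \<comment> \<open>Since \<open>p\<close> is a bijection fixing every point outside the tails, it
    maps the set of tails onto itself; hence heads and tails form the same set.\<close>
  have "p ` (- (tail G ` S)) = (\<lambda>x. x) ` (- (tail G ` S))"
    by (intro image_cong refl fixed) (rule ComplD)
  then have "- (p ` tail G ` S) = - (tail G ` S)"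
    unfolding bij_image_Compl_eq[OF permutes_bij[OF p]] image_ident .
  then have "p ` tail G ` S = tail G ` S" by (simp only: compl_eq_compl_iff)
  moreover have "inj_on (head G) S"
  proof (rule inj_onI)
    fix a b assume ab: "a \<in> S" "b \<in> S" "head G a = head G b"
    then have "tail G a = tail G b"
      using hd injD[OF permutes_inj[OF p], of "tail G a" "tail G b"] by simp
    then show "a = b" using inj_onD[OF S(2)] ab by blast
  qed
  ultimately have "S \<in> circulations G" using S(1,2) h by (simp add: circulations_def)
  moreover have "succ_perm G S = p"
    by (rule succ_perm_eqI[OF S(2)]) (simp_all add: hd fixed)
  ultimately show "S \<in> ?R" by simp
next
  fix S assume "S \<in> ?R"
  then have S: "S \<subseteq> arcs G" "inj_on (tail G) S" and q: "p = succ_perm G S"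
    by (auto simp: circulations_def)
  have "tail G ` S \<subseteq> verts G" using S(1) by auto
  moreover have "S \<subseteq> {a \<in> arcs G. head G a = p (tail G a)}"
    using S unfolding q by (auto simp: succ_perm_tail)
  moreover have "\<forall>x\<in>verts G - tail G ` S. p x = x"
    unfolding q by (simp add: succ_perm_other)
  ultimately show "S \<in> ?L" using S(2) by blast
qed

text \<open>Expanding every product and grouping by successor permutation leaves each circulation
  exactly once. Its arcs carry the weights \<open>- wt a\<close>; the resulting power of -1 cancels
  the part of the permutation sign that counts arcs, so only the number of cycles remains in the
  exponent.\<close>

lemma leibniz_sum_cycle_systems:
  fixes wt :: "'b \<Rightarrow> 'c :: comm_ring_1"
  shows "(\<Sum>p | p permutes verts G. of_int (sign p) * (\<Prod>x\<in>verts G.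
      of_bool (x = p x) - (\<Sum>a | a \<in> arcs G \<and> tail G a = x \<and> head G a = p x. wt a))) =
    (\<Sum>C\<in>cycle_systems G. (- 1) ^ card C * (\<Prod>a\<in>\<Union>C. wt a))"
proof -
  have finc: "finite (circulations G)"
    using finite_arcs by (auto simp: circulations_def intro: finite_subset[of _ "Pow (arcs G)"])
  have expand: "(\<Prod>x\<in>verts G. of_bool (x = p x) -
        (\<Sum>a | a \<in> arcs G \<and> tail G a = x \<and> head G a = p x. wt a)) =
      (\<Sum>S | S \<in> circulations G \<and> succ_perm G S = p. \<Prod>a\<in>S. - wt a)"
    if p: "p permutes verts G" for p
  proof -
    let ?X = "{a \<in> arcs G. head G a = p (tail G a)}"
    let ?D = "{S. S \<subseteq> ?X \<and> inj_on (tail G) S \<and> tail G ` S \<subseteq> verts G}"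
    have "(\<Prod>x\<in>verts G. of_bool (x = p x) -
        (\<Sum>a | a \<in> arcs G \<and> tail G a = x \<and> head G a = p x. wt a)) =
      (\<Prod>x\<in>verts G. of_bool (x = p x) + (\<Sum>a | a \<in> ?X \<and> tail G a = x. - wt a))"
      by (intro prod.cong refl) (auto simp: sum_negf intro!: sum.cong)
    also have "\<dots> = (\<Sum>S\<in>?D. (\<Prod>a\<in>S. - wt a) * (\<Prod>x\<in>verts G - tail G ` S. of_bool (x = p x)))"
      by (rule prod_add_sum_fibres) auto
    also have "\<dots> = (\<Sum>S\<in>?D. if \<forall>x\<in>verts G - tail G ` S. p x = x then \<Prod>a\<in>S. - wt a else 0)"
    proof (rule sum.cong[OF refl])
      fix S
      have "(\<Prod>x\<in>verts G - tail G ` S. of_bool (x = p x)) =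
          (of_bool (\<forall>x\<in>verts G - tail G ` S. p x = x) :: 'c)"
      proof (cases "\<forall>x\<in>verts G - tail G ` S. p x = x")
        case True
        then have "(\<Prod>x\<in>verts G - tail G ` S. of_bool (x = p x)) = (1 :: 'c)"
          by (intro prod.neutral) simp
        then show ?thesis using True by simp
      next
        case False
        then obtain x where "x \<in> verts G - tail G ` S" "p x \<noteq> x" by blast
        then show ?thesis using False by (intro trans[OF prod_zero]) (auto intro!: bexI[of _ x])
      qed
      then show "(\<Prod>a\<in>S. - wt a) * (\<Prod>x\<in>verts G - tail G ` S. of_bool (x = p x)) =
          (if \<forall>x\<in>verts G - tail G ` S. p x = x then \<Prod>a\<in>S. - wt a else 0)"
        by simp
    qed
    also have "\<dots> = (\<Sum>S | S \<in> ?D \<and> (\<forall>x\<in>verts G - tail G ` S. p x = x). \<Prod>a\<in>S. - wt a)"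
      by (rule sum.inter_filter[symmetric])
        (rule finite_subset[of _ "Pow (arcs G)"], auto)
    also have "{S. S \<in> ?D \<and> (\<forall>x\<in>verts G - tail G ` S. p x = x)} =
        {S \<in> circulations G. succ_perm G S = p}"
      unfolding circulations_with_succ_perm[OF p, symmetric] by auto
    finally show ?thesis .
  qed
  have "(\<Sum>p | p permutes verts G. of_int (sign p) * (\<Prod>x\<in>verts G.
      of_bool (x = p x) - (\<Sum>a | a \<in> arcs G \<and> tail G a = x \<and> head G a = p x. wt a))) =
    (\<Sum>p | p permutes verts G. \<Sum>S | S \<in> circulations G \<and> succ_perm G S = p.
      of_int (sign (succ_perm G S)) * (\<Prod>a\<in>S. - wt a))"
    by (intro sum.cong refl) (simp add: expand sum_distrib_left)
  also have "\<dots> = (\<Sum>S\<in>circulations G. of_int (sign (succ_perm G S)) * (\<Prod>a\<in>S. - wt a))"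
  proof (rule sum.group[OF finc])
    show "finite {p. p permutes verts G}" by (simp add: finite_permutations)
    have "tail G ` S \<subseteq> verts G" if "S \<in> circulations G" for S
      using that by (auto simp: circulations_def wellformed)
    then show "succ_perm G ` circulations G \<subseteq> {p. p permutes verts G}"
      by (auto intro!: permutes_subset[OF succ_perm_permutes])
  qed
  also have "\<dots> = (\<Sum>C\<in>cycle_systems G.
      of_int (sign (succ_perm G (\<Union>C))) * (\<Prod>a\<in>\<Union>C. - wt a))"
    by (rule sum.reindex_bij_betw[OF bij_betw_Union_cycle_systems, symmetric])
  also have "\<dots> = (\<Sum>C\<in>cycle_systems G. (- 1) ^ card C * (\<Prod>a\<in>\<Union>C. wt a))"
  proof (rule sum.cong[OF refl])
    fix C assume C: "C \<in> cycle_systems G"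
    have "(\<Prod>a\<in>\<Union>C. - wt a) = (- 1) ^ card (\<Union>C) * (\<Prod>a\<in>\<Union>C. wt a)"
      using prod.distrib[of "\<lambda>_. - 1" wt "\<Union>C"] by simp
    moreover have "(- 1) ^ (card (\<Union>C) + card C) * ((- 1) ^ card (\<Union>C) * y) = (- 1) ^ card C * y"
      for y :: 'c
      by (simp add: power_add algebra_simps flip: power_mult_distrib)
    ultimately show "of_int (sign (succ_perm G (\<Union>C))) * (\<Prod>a\<in>\<Union>C. - wt a) =
        (- 1) ^ card C * (\<Prod>a\<in>\<Union>C. wt a)"
      by (simp add: sign_succ_perm_cycle_system[OF C])
  qed
  finally show ?thesis .
qed

lemma det_eq_sum_cycle_systems:
  fixes wt :: "'b \<Rightarrow> 'c :: comm_ring_1"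
  assumes u: "bij_betw u {0..<n} (verts G)"
  shows "det (mat n n (\<lambda>(i, j). of_bool (u i = u j) -
      (\<Sum>a | a \<in> arcs G \<and> tail G a = u i \<and> head G a = u j. wt a))) =
    (\<Sum>C\<in>cycle_systems G. (- 1) ^ card C * (\<Prod>a\<in>\<Union>C. wt a))" (is "det ?M = _")
proof -
  let ?f = "\<lambda>x y. of_bool (x = y) - (\<Sum>a | a \<in> arcs G \<and> tail G a = x \<and> head G a = y. wt a)"
  have "det ?M = (\<Sum>p | p permutes {0..<n}. of_int (sign p) * (\<Prod>i\<in>{0..<n}. ?f (u i) (u (p i))))"
  proof -
    have "p i < n" if "p permutes {0..<n}" "i < n" for p i
      using that permutes_in_image[of p "{0..<n}" i] by simp
    then show ?thesis unfolding det_def by (auto intro!: sum.cong prod.cong)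
  qed
  also have "\<dots> = (\<Sum>p | p permutes verts G. of_int (sign p) * (\<Prod>x\<in>verts G. ?f x (p x)))"
    by (rule sum_permutes_reindex[OF u]) simp
  also have "\<dots> = (\<Sum>C\<in>cycle_systems G. (- 1) ^ card C * (\<Prod>a\<in>\<Union>C. wt a))"
    by (rule leibniz_sum_cycle_systems)
  finally show ?thesis .
qed

end

section \<open>The matrix determinant lemma\<close>

lemma add_diff_mat:
  fixes A B :: "'a :: ab_group_add mat"
  assumes "A \<in> carrier_mat n m" "B \<in> carrier_mat n m"
  shows "A + (B - A) = B" "B - A + A = B"
  using assms by (auto intro!: eq_matI)

text \<open>Both sides are the determinant of the block matrix with rows \<open>(D, Z)\<close> and \<open>(W, L)\<close>.\<close>

lemma det_diff_mult_inverse: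
  fixes D :: "'a :: idom mat"
  assumes D: "D \<in> carrier_mat n n" and R: "R \<in> carrier_mat n n"
    and Z: "Z \<in> carrier_mat n m" and W: "W \<in> carrier_mat m n"
    and K: "K \<in> carrier_mat m m" and L: "L \<in> carrier_mat m m"
    and DR: "D * R = 1\<^sub>m n" and KL: "K * L = 1\<^sub>m m"
  shows "det (D - Z * K * W) * det L = det D * det (L - W * R * Z)"
proof -
  have c: "Z * K \<in> carrier_mat n m" "R * Z \<in> carrier_mat n m" "W * R * Z \<in> carrier_mat m m"
    "Z * K * W \<in> carrier_mat n n" "D - Z * K * W \<in> carrier_mat n n" "L - W * R * Z \<in> carrier_mat m m"
    using assms by auto
  have DRZ: "D * (R * Z) = Z"
    using assoc_mult_mat[OF D R Z] DR Z by simp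
  have ZKL: "(Z * K) * L = Z"
    using assoc_mult_mat[OF Z K L] KL Z by simp
  have WRZ: "W * (R * Z) = W * R * Z"
    using assoc_mult_mat[OF W R Z] by simp
  let ?X = "four_block_mat D Z W L"
  \<comment> \<open>Block elimination with pivot \<open>D\<close>: \<open>R * Z\<close> reproduces
    the block \<open>Z\<close>, and the Schur complement \<open>L - W * R * Z\<close>
    remains.\<close>
  have "?X = four_block_mat D (0\<^sub>m n m) W (1\<^sub>m m) *
      four_block_mat (1\<^sub>m n) (R * Z) (0\<^sub>m m n) (L - W * R * Z)"
  proof -
    have "D * (R * Z) + 0\<^sub>m n m * (L - W * R * Z) = Z"
      unfolding DRZ left_mult_zero_mat[OF c(6)] by (rule right_add_zero_mat[OF Z])
    moreover have "W * (R * Z) + 1\<^sub>m m * (L - W * R * Z) = L"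
      unfolding WRZ left_mult_one_mat[OF c(6)] by (rule add_diff_mat(1)[OF c(3) L])
    moreover have "D * 1\<^sub>m n + 0\<^sub>m n m * 0\<^sub>m m n = D"
      unfolding right_mult_one_mat[OF D] left_mult_zero_mat[OF zero_carrier_mat]
      by (rule right_add_zero_mat[OF D])
    moreover have "W * 1\<^sub>m n + 1\<^sub>m m * 0\<^sub>m m n = W"
      unfolding right_mult_one_mat[OF W] left_mult_one_mat[OF zero_carrier_mat]
      by (rule right_add_zero_mat[OF W])
    ultimately show ?thesis
      by (simp only: mult_four_block_mat[OF D zero_carrier_mat W one_carrier_mat
            one_carrier_mat c(2) zero_carrier_mat c(6)])
  qed
  then have "det ?X = det (four_block_mat D (0\<^sub>m n m) W (1\<^sub>m m)) *
      det (four_block_mat (1\<^sub>m n) (R * Z) (0\<^sub>m m n) (L - W * R * Z))"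
    using det_mult[OF four_block_carrier_mat[OF D one_carrier_mat]
        four_block_carrier_mat[OF one_carrier_mat c(6)]] by simp
  also have "\<dots> = det D * det (L - W * R * Z)"
    using det_four_block_mat_upper_right_zero[OF D refl W one_carrier_mat]
      det_four_block_mat_lower_left_zero[OF one_carrier_mat c(2) refl c(6)] by simp
  finally have 1: "det ?X = det D * det (L - W * R * Z)" .
  \<comment> \<open>Block elimination with pivot \<open>L\<close>: its inverse \<open>K\<close>
    leaves the Schur complement \<open>D - Z * K * W\<close>.\<close>
  have "?X = four_block_mat (1\<^sub>m n) (Z * K) (0\<^sub>m m n) (1\<^sub>m m) *
      four_block_mat (D - Z * K * W) (0\<^sub>m n m) W L"
  proof -
    have "1\<^sub>m n * (D - Z * K * W) + Z * K * W = D"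
      unfolding left_mult_one_mat[OF c(5)] by (rule add_diff_mat(2)[OF c(4) D])
    moreover have "1\<^sub>m n * 0\<^sub>m n m + Z * K * L = Z"
      unfolding ZKL left_mult_one_mat[OF zero_carrier_mat] by (rule left_add_zero_mat[OF Z])
    moreover have "0\<^sub>m m n * (D - Z * K * W) + 1\<^sub>m m * W = W"
      unfolding left_mult_zero_mat[OF c(5)] left_mult_one_mat[OF W] by (rule left_add_zero_mat[OF W])
    moreover have "0\<^sub>m m n * 0\<^sub>m n m + 1\<^sub>m m * L = L"
      unfolding left_mult_zero_mat[OF zero_carrier_mat] left_mult_one_mat[OF L]
      by (rule left_add_zero_mat[OF L])
    ultimately show ?thesis
      by (simp only: mult_four_block_mat[OF one_carrier_mat c(1) zero_carrier_mat one_carrier_mat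
            c(5) zero_carrier_mat W L])
  qed
  then have "det ?X = det (four_block_mat (1\<^sub>m n) (Z * K) (0\<^sub>m m n) (1\<^sub>m m)) *
      det (four_block_mat (D - Z * K * W) (0\<^sub>m n m) W L)"
    using det_mult[OF four_block_carrier_mat[OF one_carrier_mat one_carrier_mat]
        four_block_carrier_mat[OF c(5) L]] by simp
  also have "\<dots> = det (D - Z * K * W) * det L"
    using det_four_block_mat_upper_right_zero[OF c(5) refl W L]
      det_four_block_mat_lower_left_zero[OF one_carrier_mat c(1) refl one_carrier_mat] by simp
  finally show ?thesis using 1 by simp
qed

section \<open>Path counts\<close>

context fin_digraph
begin

text \<open>If the start of a walk occurred again later, the walk up to there would be closed and
  contain a cycle.\<close>

lemma acyclic_awalk_imp_apath:
  assumes ac: "acyclic_digraph G" and p: "awalk x p y"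
  shows "apath x p y"
  using p
proof (induction p arbitrary: x)
  case (Cons a p)
  have a: "a \<in> arcs G" "x = tail G a" "awalk (head G a) p y"
    using Cons.prems by (auto simp: awalk_Cons_iff)
  have "x \<notin> set (awalk_verts (head G a) p)"
  proof
    assume "x \<in> set (awalk_verts (head G a) p)"
    then obtain q where "awalk (head G a) q x" using awalk_decomp[OF a(3)] by blast
    then have "awalk x (a # q) x" using a by (auto simp: awalk_Cons_iff)
    then have "closed_w (a # q)" by (auto simp: closed_w_def)
    then show False using closed_w_imp_cycle ac by (auto simp: acyclic_digraph_def)
  qed
  then show ?case using Cons.IH[OF a(3)] a by (auto simp: apath_Cons_iff)
qed (auto simp: apath_Nil_iff awalk_Nil_iff)

lemma num_paths_outside: "x \<notin> verts G \<or> y \<notin> verts G \<Longrightarrow> num_paths G x y = 0"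
  using awalk_hd_in_verts awalk_last_in_verts unfolding num_paths_def apath_def
  by (metis (no_types, lifting) Collect_empty_eq card.empty)

text \<open>A nonempty path is a first arc followed by a path from its head. Conversely, prefixing
  an arc could repeat a vertex in general, but acyclicity excludes this. Read as a matrix equation,
  the recursion says that path counts invert \<open>I - N\<close>.\<close>

lemma num_paths_first_step:
  assumes ac: "acyclic_digraph G"
  shows "num_paths G x y = of_bool (x = y \<and> x \<in> verts G) +
    (\<Sum>a | a \<in> arcs G \<and> tail G a = x. num_paths G (head G a) y)"
proof -
  let ?P = "\<lambda>x. {p. apath x p y}"
  let ?A = "{a. a \<in> arcs G \<and> tail G a = x}"
  let ?N = "{p :: 'b list. p = [] \<and> x = y \<and> x \<in> verts G}"
  let ?U = "\<Union>a\<in>?A. (#) a ` ?P (head G a)"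
  have fin: "finite (?P z)" for z by (rule apaths_finite)
  have cons: "apath x (a # p) y \<longleftrightarrow> a \<in> arcs G \<and> tail G a = x \<and> apath (head G a) p y" for x a p
    using acyclic_awalk_imp_apath[OF ac, of x "a # p" y]
      acyclic_awalk_imp_apath[OF ac, of "head G a" p y] awalkI_apath[of x "a # p" y]
      awalkI_apath[of "head G a" p y] awalk_Cons_iff[of x a p y] by blast
  have split: "?P x = ?N \<union> ?U"
  proof (intro equalityI subsetI)
    fix p assume "p \<in> ?P x"
    then show "p \<in> ?N \<union> ?U"
      by (cases p) (auto simp: cons apath_Nil_iff)
  qed (auto simp: cons apath_Nil_iff)
  have "card (?P x) = card ?N + card ?U"
    unfolding split by (rule card_Un_disjoint) (use fin in auto)
  also have "card ?N = of_bool (x = y \<and> x \<in> verts G)"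
    by (cases "x = y \<and> x \<in> verts G") auto
  also have "card ?U = (\<Sum>a\<in>?A. card ((#) a ` ?P (head G a)))"
    by (rule card_UN_disjoint) (use fin in auto)
  also have "\<dots> = (\<Sum>a\<in>?A. card (?P (head G a)))"
    by (intro sum.cong refl card_image) auto
  finally show ?thesis unfolding num_paths_def .
qed

text \<open>Turns a row of a product with the weighted adjacency matrix, a sum over intermediate
  vertices, into a sum over outgoing arcs, the shape of the first-step recursion.\<close>

lemma sum_arcs_between:
  fixes f :: "'b \<Rightarrow> 'c :: comm_ring_1"
  shows "(\<Sum>z\<in>verts G. (\<Sum>a | a \<in> arcs G \<and> tail G a = x \<and> head G a = z. f a) * g z) =
    (\<Sum>a | a \<in> arcs G \<and> tail G a = x. f a * g (head G a))"
proof -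
  have "(\<Sum>z\<in>verts G. (\<Sum>a | a \<in> arcs G \<and> tail G a = x \<and> head G a = z. f a) * g z) =
    (\<Sum>z\<in>verts G. \<Sum>a | a \<in> {a. a \<in> arcs G \<and> tail G a = x} \<and> head G a = z. f a * g (head G a))"
    by (intro sum.cong refl) (auto simp: sum_distrib_right intro!: sum.cong)
  also have "\<dots> = (\<Sum>a | a \<in> arcs G \<and> tail G a = x. f a * g (head G a))"
    by (rule sum.group) auto
  finally show ?thesis .
qed

end

lemma sum_lessThan_double:
  fixes f :: "nat \<Rightarrow> 'c :: comm_monoid_add"
  shows "(\<Sum>a\<in>{0..<k + k}. f a) = (\<Sum>i\<in>{1..k}. f (i - 1)) + (\<Sum>i\<in>{1..k}. f (k + (i - 1)))"
proof -
  have "(\<Sum>a\<in>{0..<k + k}. f a) = (\<Sum>a\<in>{0..<k}. f a) + (\<Sum>a\<in>{k..<k + k}. f a)"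
    by (rule sum.atLeastLessThan_concat[symmetric]) auto
  also have "(\<Sum>a\<in>{0..<k}. f a) = (\<Sum>i\<in>{1..k}. f (i - 1))"
    by (rule sum.reindex_bij_witness[of _ "\<lambda>i. i - 1" Suc]) auto
  also have "(\<Sum>a\<in>{k..<k + k}. f a) = (\<Sum>i\<in>{1..k}. f (k + (i - 1)))"
    by (rule sum.reindex_bij_witness[of _ "\<lambda>i. k + (i - 1)" "\<lambda>a. Suc a - k"]) auto
  finally show ?thesis .
qed

section \<open>Hamburger graphs\<close>

context hamburger_graph
begin

section \<open>Paths and cycles that avoid the connecting arcs\<close>

sublocale G1: fin_digraph G1 by (rule fin_digraph_subgraph[OF subgraph_G1])
sublocale G2: fin_digraph G2 by (rule fin_digraph_subgraph[OF subgraph_G2])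

lemma incidence [simp]: "tail G1 = tail H" "head G1 = head H" "tail G2 = tail H" "head G2 = head H"
  using subgraph_G1 subgraph_G2 by (auto simp: subgraph_def compatible_def)

text \<open>Used as a weight on \<open>H\<close>, it switches the connecting arcs off without
  changing the digraph, so one cycle system expansion serves both determinants.\<close>

definition inner :: "'b \<Rightarrow> int" where
  "inner a = of_bool (a \<in> arcs G1 \<union> arcs G2)"

definition wt :: "'b \<Rightarrow> int" where
  "wt a = (if tail H a \<in> verts G2 \<and> head H a \<in> verts G1 then - 1 else 1)"

text \<open>At most one summand is nonzero because the halves share no vertex; the sum counts the
  paths of \<open>H\<close> without connecting arcs.\<close>

definition paths :: "'a \<Rightarrow> 'a \<Rightarrow> int" where
  "paths x y = int (num_paths G1 x y) + int (num_paths G2 x y)"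

lemma arc_ends:
  "a \<in> arcs G1 \<Longrightarrow> tail H a \<in> verts G1 \<and> head H a \<in> verts G1"
  "a \<in> arcs G2 \<Longrightarrow> tail H a \<in> verts G2 \<and> head H a \<in> verts G2"
  using G1.wellformed[of a] G2.wellformed[of a] by simp_all

lemma distinguished_in:
  "i \<in> {1..k} \<Longrightarrow> v i \<in> verts G1" "i \<in> {1..k} \<Longrightarrow> w (k + i) \<in> verts G2"
  using v_in_G1 w_in_G2 by (auto simp: image_subset_iff)

lemma paths_first_step:
  assumes "x \<in> verts H"
  shows "paths x y = of_bool (x = y) +
    (\<Sum>a | a \<in> arcs H \<and> tail H a = x. inner a * paths (head H a) y)"
proof -
  have sub: "arcs G1 \<union> arcs G2 \<subseteq> arcs H" using arcs_H by auto
  have disj: "arcs G1 \<inter> arcs G2 = {}" using arc_ends verts_disjoint by blast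
  \<comment> \<open>An arc of one half ends in that half, where no path of the other half starts; so
    the recursions of the halves can be added without mixed terms.\<close>
  have o1: "num_paths G2 (head H a) y = 0" if "a \<in> arcs G1" for a
    using that arc_ends verts_disjoint by (intro G2.num_paths_outside) auto
  have o2: "num_paths G1 (head H a) y = 0" if "a \<in> arcs G2" for a
    using that arc_ends verts_disjoint by (intro G1.num_paths_outside) auto
  have "(\<Sum>a | a \<in> arcs H \<and> tail H a = x. inner a * paths (head H a) y) =
    (\<Sum>a\<in>{a. a \<in> arcs G1 \<and> tail H a = x} \<union> {a. a \<in> arcs G2 \<and> tail H a = x}. paths (head H a) y)"
    by (rule sum.mono_neutral_cong_right) (use sub in \<open>auto simp: inner_def\<close>)
  also have "\<dots> = (\<Sum>a | a \<in> arcs G1 \<and> tail H a = x. paths (head H a) y) +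
      (\<Sum>a | a \<in> arcs G2 \<and> tail H a = x. paths (head H a) y)"
    by (rule sum.union_disjoint) (use disj in auto)
  also have "\<dots> = (\<Sum>a | a \<in> arcs G1 \<and> tail H a = x. int (num_paths G1 (head H a) y)) +
      (\<Sum>a | a \<in> arcs G2 \<and> tail H a = x. int (num_paths G2 (head H a) y))"
    by (intro arg_cong2[of _ _ _ _ "(+)"] sum.cong) (auto simp: paths_def o1 o2)
  finally show ?thesis
    using G1.num_paths_first_step[OF acyclic_G1, of x y] G2.num_paths_first_step[OF acyclic_G2, of x y]
      assms verts_disjoint unfolding paths_def verts_H by (auto simp: of_bool_def)
qed

text \<open>Without connecting arcs a cycle cannot change halves: its arcs in \<open>G1\<close> are
  closed under successors, so by minimality it lies in one half, which is acyclic.\<close>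

lemma dicycle_not_inner:
  assumes "c \<in> dicycles H"
  shows "\<not> c \<subseteq> arcs G1 \<union> arcs G2"
proof
  assume sub: "c \<subseteq> arcs G1 \<union> arcs G2"
  obtain p where p: "c = set p" "p \<noteq> []" "distinct (map (tail H) p)"
     "map (head H) p = rotate1 (map (tail H) p)"
    using assms by (auto simp: dicycles_def cycle_iff_rotate)
  have "\<not> c \<subseteq> arcs G1"
    using p G1.cycle_iff_rotate[of p] acyclic_G1 by (auto simp: acyclic_digraph_def)
  moreover have "\<not> c \<subseteq> arcs G2"
    using p G2.cycle_iff_rotate[of p] acyclic_G2 by (auto simp: acyclic_digraph_def)
  moreover have "c \<inter> arcs G1 = c" if "c \<inter> arcs G1 \<noteq> {}"
  proof (rule dicycle_minimal[OF assms _ that])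
    fix a b assume "a \<in> c \<inter> arcs G1" "b \<in> c" "tail H b = head H a"
    then show "b \<in> c \<inter> arcs G1" using arc_ends verts_disjoint sub by (metis IntD2 IntI UnE disjoint_iff subsetD)
  qed simp
  ultimately show False using sub by blast
qed

text \<open>Every cycle uses a connecting arc, of weight 0, so only the empty system contributes.
  This is the value of \<open>det D\<close>.\<close>

lemma sum_inner_cycle_systems:
  "(\<Sum>C\<in>cycle_systems H. (- 1) ^ card C * (\<Prod>a\<in>\<Union>C. inner a)) = 1"
proof -
  have "(\<Sum>C\<in>cycle_systems H. (- 1) ^ card C * (\<Prod>a\<in>\<Union>C. inner a)) =
      (\<Sum>C\<in>{{}}. (- 1) ^ card C * (\<Prod>a\<in>\<Union>C. inner a))"
  proof (rule sum.mono_neutral_right[OF finite_cycle_systems])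
    show "{{}} \<subseteq> cycle_systems H" by (simp add: cycle_systems_def)
    show "\<forall>C\<in>cycle_systems H - {{}}. (- 1) ^ card C * (\<Prod>a\<in>\<Union>C. inner a) = 0"
    proof
      fix C assume C: "C \<in> cycle_systems H - {{}}"
      then obtain c where "c \<in> C" "c \<in> dicycles H" by (auto simp: cycle_systems_def)
      then obtain a where "a \<in> \<Union>C" "a \<notin> arcs G1 \<union> arcs G2"
        using dicycle_not_inner[of c] by blast
      then have "a \<in> \<Union>C" "inner a = 0" by (auto simp: inner_def)
      then show "(- 1) ^ card C * (\<Prod>a\<in>\<Union>C. inner a) = 0"
        using cycle_system_finite(2)[of C] C by (metis DiffD1 mult_zero_right prod_zero)
    qed
  qed
  then show ?thesis by simp
qed

section \<open>Signs of cycle systems and weights of connecting arcs\<close>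

lemma sign_eq_weight:
  assumes "C \<in> cycle_systems H"
  shows "cycle_system_sign H G1 G2 C = (- 1) ^ card C * (\<Prod>a\<in>\<Union>C. wt a)"
proof -
  have "(\<Prod>a\<in>\<Union>C. wt a) =
      (- 1) ^ card {a \<in> \<Union>C. tail H a \<in> verts G2 \<and> head H a \<in> verts G1}"
    unfolding wt_def using cycle_system_finite(2)[OF assms]
    by (simp add: prod.If_cases Int_def)
  then show ?thesis by (simp add: cycle_system_sign_def power_add)
qed

lemma num_cycle_systems_eq_sum:
  "int (num_positive_cycle_systems H G1 G2) - int (num_negative_cycle_systems H G1 G2) =
    (\<Sum>C\<in>cycle_systems H. (- 1) ^ card C * (\<Prod>a\<in>\<Union>C. wt a))"
proof -
  let ?s = "cycle_system_sign H G1 G2"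
  have "?s C = of_bool (?s C = 1) - of_bool (?s C = - 1)" for C
    unfolding cycle_system_sign_def by (simp add: minus_one_power_iff)
  then have "(\<Sum>C\<in>cycle_systems H. ?s C) =
      (\<Sum>C\<in>cycle_systems H. of_bool (?s C = 1) - of_bool (?s C = - 1))"
    by (intro sum.cong refl) blast
  also have "\<dots> = int (num_positive_cycle_systems H G1 G2) - int (num_negative_cycle_systems H G1 G2)"
    unfolding num_positive_cycle_systems_def num_negative_cycle_systems_def sum_subtractf
    using finite_cycle_systems by (simp add: of_bool_def sum.If_cases Int_def)
  finally show ?thesis using sign_eq_weight by simp
qed

lemma connecting_arcs_disjoint:
  assumes "i \<in> {1..k}" "j \<in> {1..k}"
  shows "e i \<notin> arcs G1" "e i \<notin> arcs G2" "e' i \<notin> arcs G1" "e' i \<notin> arcs G2" "e i \<noteq> e' j"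
proof -
  have "tail H (e i) \<in> verts G1" "head H (e i) \<in> verts G2"
    "tail H (e' i) \<in> verts G2" "head H (e' i) \<in> verts G1" "tail H (e' j) \<in> verts G2"
    using assms distinguished_in by (auto simp: tail_e head_e tail_e' head_e')
  then show "e i \<notin> arcs G1" "e i \<notin> arcs G2" "e' i \<notin> arcs G1" "e' i \<notin> arcs G2" "e i \<noteq> e' j"
    using arc_ends verts_disjoint by (metis disjoint_iff)+
qed

lemma inj_on_connecting: "inj_on e {1..k}" "inj_on e' {1..k}"
proof -
  show "inj_on e {1..k}"
    by (rule inj_onI) (metis inj_onD tail_e v_inj)
  show "inj_on e' {1..k}"
    by (rule inj_onI) (metis inj_onD head_e' v_inj)
qed

text \<open>The two weights agree on the arcs of the halves and differ by 1 at each
  \<open>e i\<close> and by -1 at each \<open>e' i\<close>. The difference is the perturbation that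
  is later factored as \<open>Z * K * W\<close>.\<close>

lemma sum_wt_between:
  "(\<Sum>a | a \<in> arcs H \<and> tail H a = x \<and> head H a = y. wt a) =
    (\<Sum>a | a \<in> arcs H \<and> tail H a = x \<and> head H a = y. inner a) +
    (\<Sum>i\<in>{1..k}. of_bool (x = v i \<and> y = w (k + i))) -
    (\<Sum>i\<in>{1..k}. of_bool (x = w (k + i) \<and> y = v i))"
proof -
  let ?b = "\<lambda>a. of_bool (tail H a = x \<and> head H a = y) :: int"
  have conv: "(\<Sum>a | a \<in> arcs H \<and> tail H a = x \<and> head H a = y. f a) = (\<Sum>a\<in>arcs H. ?b a * f a)"
    for f :: "'b \<Rightarrow> int"
    by (rule sum.mono_neutral_cong_left) auto
  let ?A = "arcs G1 \<union> arcs G2"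
  have split: "(\<Sum>a\<in>arcs H. h a) = (\<Sum>a\<in>?A. h a) + (\<Sum>i\<in>{1..k}. h (e i)) + (\<Sum>i\<in>{1..k}. h (e' i))"
    for h :: "'b \<Rightarrow> int"
  proof -
    have "(\<Sum>a\<in>arcs H. h a) = (\<Sum>a\<in>?A \<union> e ` {1..k}. h a) + (\<Sum>a\<in>e' ` {1..k}. h a)"
      unfolding arcs_H
    proof (rule sum.union_disjoint)
      show "(?A \<union> e ` {1..k}) \<inter> e' ` {1..k} = {}" using connecting_arcs_disjoint by fastforce
    qed auto
    also have "(\<Sum>a\<in>?A \<union> e ` {1..k}. h a) = (\<Sum>a\<in>?A. h a) + (\<Sum>a\<in>e ` {1..k}. h a)"
      using connecting_arcs_disjoint by (intro sum.union_disjoint) auto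
    finally show ?thesis
      unfolding sum.reindex[OF inj_on_connecting(1)] sum.reindex[OF inj_on_connecting(2)] o_def .
  qed
  have in_wt: "wt a = 1" "inner a = 1" if "a \<in> ?A" for a
    using that arc_ends verts_disjoint by (auto simp: wt_def inner_def)
  have e: "wt (e i) = 1" "wt (e' i) = - 1" "inner (e i) = 0" "inner (e' i) = 0" if "i \<in> {1..k}" for i
    using that distinguished_in[OF that] verts_disjoint connecting_arcs_disjoint[OF that that]
    by (auto simp: wt_def inner_def tail_e head_e tail_e' head_e')
  have "(\<Sum>i\<in>{1..k}. ?b (e i) * wt (e i)) = (\<Sum>i\<in>{1..k}. of_bool (x = v i \<and> y = w (k + i)))"
    by (intro sum.cong refl) (auto simp: e tail_e head_e)
  moreover have "(\<Sum>i\<in>{1..k}. ?b (e' i) * wt (e' i)) =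
      - (\<Sum>i\<in>{1..k}. of_bool (x = w (k + i) \<and> y = v i))"
    unfolding sum_negf[symmetric] by (intro sum.cong refl) (auto simp: e tail_e' head_e')
  moreover have "(\<Sum>i\<in>{1..k}. ?b (e i) * inner (e i)) = 0" "(\<Sum>i\<in>{1..k}. ?b (e' i) * inner (e' i)) = 0"
    using e by (auto intro!: sum.neutral)
  moreover have "(\<Sum>a\<in>?A. ?b a * wt a) = (\<Sum>a\<in>?A. ?b a * inner a)"
    by (intro sum.cong refl) (simp add: in_wt)
  ultimately show ?thesis unfolding conv split by simp
qed

text \<open>The distinguished vertex that belongs to row \<open>a\<close> of the hamburger matrix, counted from 0.\<close>

definition distinguished_vert :: "nat \<Rightarrow> 'a" where
  "distinguished_vert a = (if a < k then v (a + 1) else w (a + 1))"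

lemma distinguished_vert_in:
  assumes "a < k + k"
  shows "distinguished_vert a \<in> (if a < k then verts G1 else verts G2)"
proof (cases "a < k")
  case True
  then show ?thesis using distinguished_in(1)[of "a + 1"] by (simp add: distinguished_vert_def)
next
  case False
  then have "k + (a + 1 - k) = a + 1" "a + 1 - k \<in> {1..k}" using assms by auto
  then show ?thesis using False distinguished_in(2)[of "a + 1 - k"] by (simp add: distinguished_vert_def)
qed

lemma distinguished_vert_notin: "a < k + k \<Longrightarrow> distinguished_vert a \<notin> (if a < k then verts G2 else verts G1)"
  using distinguished_vert_in[of a] verts_disjoint by (auto split: if_splits)

lemma distinguished_vert_in_verts: "a < k + k \<Longrightarrow> distinguished_vert a \<in> verts H"
  using distinguished_vert_in[of a] by (auto simp: verts_H split: if_splits)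

lemma det_hamburger_matrix:
  "det (hamburger_matrix G1 G2 k v w) =
    (\<Sum>C\<in>cycle_systems H. (- 1) ^ card C * (\<Prod>a\<in>\<Union>C. wt a))"
proof -
  define n where "n = card (verts H)"
  define N where "N f x y = (\<Sum>a | a \<in> arcs H \<and> tail H a = x \<and> head H a = y. f a)"
    for f :: "'b \<Rightarrow> int" and x y
  obtain u where u: "bij_betw u {0..<n} (verts H)"
    unfolding n_def using ex_bij_betw_nat_finite[OF finite_verts] by blast
  have u_in: "u i \<in> verts H" if "i < n" for i using bij_betwE[OF u] that by simp
  have sum_u: "(\<Sum>i\<in>{0..<n}. g (u i)) = (\<Sum>x\<in>verts H. g x)" for g :: "'a \<Rightarrow> int"
    by (rule sum.reindex_bij_betw[OF u])
  define D where "D = mat n n (\<lambda>(i, j). of_bool (u i = u j) - N inner (u i) (u j))"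
  define R where "R = mat n n (\<lambda>(i, j). paths (u i) (u j))"
  \<comment> \<open>\<open>W\<close> selects the rows and \<open>Z\<close> the columns of the
    distinguished vertices. The minus sign in \<open>Z\<close> makes \<open>L - W * R * Z\<close>
    add the path counts to \<open>L\<close>.\<close>
  define Z where "Z = mat n (k + k) (\<lambda>(i, a). - of_bool (u i = distinguished_vert a) :: int)"
  define W where "W = mat (k + k) n (\<lambda>(a, j). of_bool (u j = distinguished_vert a) :: int)"
  \<comment> \<open>\<open>L\<close> is the hamburger matrix without its path counts, and
    \<open>K\<close> is its inverse. With the sign of \<open>Z\<close>, the entries of
    \<open>K\<close> yield 1 for the arcs \<open>e i\<close> and -1 for the arcs
    \<open>e' i\<close>.\<close>
  define K :: "int mat" where "K = four_block_mat (0\<^sub>m k k) (- 1\<^sub>m k) (1\<^sub>m k) (0\<^sub>m k k)"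
  define L :: "int mat" where "L = four_block_mat (0\<^sub>m k k) (1\<^sub>m k) (- 1\<^sub>m k) (0\<^sub>m k k)"
  have carr: "D \<in> carrier_mat n n" "R \<in> carrier_mat n n" "Z \<in> carrier_mat n (k + k)"
    "W \<in> carrier_mat (k + k) n" "K \<in> carrier_mat (k + k) (k + k)" "L \<in> carrier_mat (k + k) (k + k)"
    unfolding D_def R_def Z_def W_def K_def L_def by auto
  have DR: "D * R = 1\<^sub>m n"
  proof (rule eq_matI)
    fix i j assume "i < dim_row (1\<^sub>m n)" "j < dim_col (1\<^sub>m n)"
    then have ij: "i < n" "j < n" by auto
    have "(D * R) $$ (i, j) =
        (\<Sum>l\<in>{0..<n}. (of_bool (u i = u l) - N inner (u i) (u l)) * paths (u l) (u j))"
      using ij unfolding D_def R_def by (simp add: scalar_prod_def)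
    also have "\<dots> = (\<Sum>z\<in>verts H. (of_bool (u i = z) - N inner (u i) z) * paths z (u j))"
      by (rule sum_u)
    also have "\<dots> = (\<Sum>z\<in>verts H. of_bool (u i = z) * paths z (u j)) -
        (\<Sum>z\<in>verts H. N inner (u i) z * paths z (u j))"
      by (simp add: left_diff_distrib sum_subtractf)
    also have "(\<Sum>z\<in>verts H. of_bool (u i = z) * paths z (u j)) = paths (u i) (u j)"
      using u_in[OF ij(1)] by (simp add: of_bool_def if_distrib[of "\<lambda>t. t * _"] cong: if_cong)
    also have "(\<Sum>z\<in>verts H. N inner (u i) z * paths z (u j)) =
        paths (u i) (u j) - of_bool (u i = u j)"
      unfolding N_def sum_arcs_between using paths_first_step[OF u_in[OF ij(1)], of "u j"] by simp
    also have "of_bool (u i = u j) = of_bool (i = j)"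
      using u ij by (auto simp: bij_betw_def inj_on_def)
    finally show "(D * R) $$ (i, j) = 1\<^sub>m n $$ (i, j)" using ij by simp
  qed (use carr in auto)
  have KL: "K * L = 1\<^sub>m (k + k)"
    unfolding K_def L_def
    by (subst mult_four_block_mat[where ?nr1.0 = k and ?n1.0 = k and ?n2.0 = k and ?nr2.0 = k
          and ?nc1.0 = k and ?nc2.0 = k]) (auto intro!: eq_matI)
  have detL: "det L = 1"
  proof -
    have "0\<^sub>m k k * 0\<^sub>m k k - 1\<^sub>m k * - 1\<^sub>m k = (1\<^sub>m k :: int mat)" by (intro eq_matI) auto
    then show ?thesis unfolding L_def by (subst det_four_block_mat[where n = k]) auto
  qed
  have detD: "det D = 1"
    using det_eq_sum_cycle_systems[OF u, of inner] sum_inner_cycle_systems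
    unfolding D_def N_def by simp
  have ZKW: "(Z * K * W) $$ (i, j) = N wt (u i) (u j) - N inner (u i) (u j)"
    if ij: "i < n" "j < n" for i j
  proof -
    \<comment> \<open>Each column of \<open>K\<close> has a single nonzero entry, in row
      \<open>k + b\<close> or \<open>b - k\<close>, so multiplication by \<open>K\<close> exchanges
      the two partners of a distinguished pair up to sign.\<close>
    have ZK: "(Z * K) $$ (i, b) =
        (if b < k then - of_bool (u i = distinguished_vert (k + b)) else of_bool (u i = distinguished_vert (b - k)))"
      if "b < k + k" for b
    proof -
      have "(Z * K) $$ (i, b) = (\<Sum>a\<in>{0..<k + k}. - of_bool (u i = distinguished_vert a) * K $$ (a, b))"
        using ij that carr unfolding Z_def by (simp add: scalar_prod_def)
      also have "\<dots> = (\<Sum>a\<in>{0..<k + k}. if b < k then (if a = k + b then - of_bool (u i = distinguished_vert a) else 0)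
          else (if a = b - k then of_bool (u i = distinguished_vert a) else 0))"
        using that by (intro sum.cong refl) (auto simp: K_def)
      also have "\<dots> = (if b < k then - of_bool (u i = distinguished_vert (k + b)) else of_bool (u i = distinguished_vert (b - k)))"
        using that by (cases "b < k") auto
      finally show ?thesis .
    qed
    have "(Z * K * W) $$ (i, j) = (\<Sum>b\<in>{0..<k + k}. (Z * K) $$ (i, b) * of_bool (u j = distinguished_vert b))"
      using ij carr unfolding W_def by (simp add: scalar_prod_def)
    also have "\<dots> = (\<Sum>b\<in>{0..<k + k}.
        (if b < k then - of_bool (u i = distinguished_vert (k + b)) else of_bool (u i = distinguished_vert (b - k))) *
        of_bool (u j = distinguished_vert b))"
      by (intro sum.cong refl) (simp add: ZK)
    also have "\<dots> = - (\<Sum>l\<in>{1..k}. of_bool (u i = w (k + l) \<and> u j = v l)) +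
        (\<Sum>l\<in>{1..k}. of_bool (u i = v l \<and> u j = w (k + l)))"
      unfolding sum_lessThan_double sum_negf[symmetric]
      by (intro arg_cong2[of _ _ _ _ "(+)"] sum.cong refl) (auto simp: distinguished_vert_def)
    finally show ?thesis unfolding N_def sum_wt_between by simp
  qed
  have WRZ: "(W * R * Z) $$ (a, b) = - paths (distinguished_vert a) (distinguished_vert b)"
    if ab: "a < k + k" "b < k + k" for a b
  proof -
    have WR: "(W * R) $$ (a, j) = paths (distinguished_vert a) (u j)" if "j < n" for j
    proof -
      have "(W * R) $$ (a, j) = (\<Sum>i\<in>{0..<n}. of_bool (u i = distinguished_vert a) * paths (u i) (u j))"
        using that ab unfolding W_def R_def by (simp add: scalar_prod_def)
      also have "\<dots> = (\<Sum>x\<in>verts H. of_bool (x = distinguished_vert a) * paths x (u j))" by (rule sum_u)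
      also have "\<dots> = paths (distinguished_vert a) (u j)"
        using distinguished_vert_in_verts[OF ab(1)]
        by (simp add: of_bool_def if_distrib[of "\<lambda>t. t * _"] cong: if_cong)
      finally show ?thesis .
    qed
    have "(W * R * Z) $$ (a, b) = (\<Sum>j\<in>{0..<n}. (W * R) $$ (a, j) * - of_bool (u j = distinguished_vert b))"
      using ab carr unfolding Z_def by (simp add: scalar_prod_def)
    also have "\<dots> = (\<Sum>j\<in>{0..<n}. paths (distinguished_vert a) (u j) * - of_bool (u j = distinguished_vert b))"
      by (intro sum.cong refl) (simp add: WR)
    also have "\<dots> = (\<Sum>x\<in>verts H. paths (distinguished_vert a) x * - of_bool (x = distinguished_vert b))" by (rule sum_u)
    also have "\<dots> = - paths (distinguished_vert a) (distinguished_vert b)"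
      using distinguished_vert_in_verts[OF ab(2)]
      by (simp add: of_bool_def if_distrib[of "\<lambda>t. _ * t"] sum_negf cong: if_cong)
    finally show ?thesis .
  qed
  have "hamburger_matrix G1 G2 k v w = L - W * R * Z"
  proof (rule eq_matI)
    fix a b assume "a < dim_row (L - W * R * Z)" "b < dim_col (L - W * R * Z)"
    then have ab: "a < k + k" "b < k + k" using carr by auto
    \<comment> \<open>No counted path joins the two halves, so the off-diagonal blocks come from
      \<open>L\<close> alone and the diagonal blocks from the path counts alone.\<close>
    have "paths (distinguished_vert a) (distinguished_vert b) =
        (if a < k then if b < k then int (num_paths G1 (v (a + 1)) (v (b + 1))) else 0
         else if b < k then 0 else int (num_paths G2 (w (a + 1)) (w (b + 1))))"
      using distinguished_vert_notin[OF ab(1)] distinguished_vert_notin[OF ab(2)]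
      by (auto simp: paths_def distinguished_vert_def G1.num_paths_outside G2.num_paths_outside split: if_splits)
    moreover have "(L - W * R * Z) $$ (a, b) = L $$ (a, b) + paths (distinguished_vert a) (distinguished_vert b)"
      using index_minus_mat(1)[of a "W * R * Z" b L] WRZ[OF ab] ab carr by simp
    ultimately show "hamburger_matrix G1 G2 k v w $$ (a, b) = (L - W * R * Z) $$ (a, b)"
      using ab by (auto simp: hamburger_matrix_def L_def)
  qed (use carr in \<open>auto simp: hamburger_matrix_def\<close>)
  then have "det (hamburger_matrix G1 G2 k v w) = det (D - Z * K * W)"
    using det_diff_mult_inverse[OF carr DR KL] detL detD by simp
  also have "D - Z * K * W = mat n n (\<lambda>(i, j). of_bool (u i = u j) - N wt (u i) (u j))"
    by (rule eq_matI) (use carr ZKW in \<open>auto simp: D_def\<close>)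
  also have "det \<dots> = (\<Sum>C\<in>cycle_systems H. (- 1) ^ card C * (\<Prod>a\<in>\<Union>C. wt a))"
    unfolding N_def by (rule det_eq_sum_cycle_systems[OF u])
  finally show ?thesis .
qed

end

theorem theorem1p1:
  fixes H G1 G2 :: "('a, 'b) pre_digraph"
    and k :: nat
    and v w :: "nat \<Rightarrow> 'a"
    and e e' :: "nat \<Rightarrow> 'b"
  assumes "hamburger_graph H G1 G2 k v w e e'"
  shows "det (hamburger_matrix G1 G2 k v w)
    = int (num_positive_cycle_systems H G1 G2) - int (num_negative_cycle_systems H G1 G2)"
  using hamburger_graph.det_hamburger_matrix[OF assms]
    hamburger_graph.num_cycle_systems_eq_sum[OF assms] by simp

end
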